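(* Let $A$ be a Banach algebra with a right identity $u$, let $B$ be a Banach algebra, and let $\theta,\phi,\gamma$ be nonzero multiplicative linear functionals on $B$. Let $d\in\mathrm{Der}_J(A\times_\theta^{\phi,\gamma}B)$, with associated Jordan derivations $d_A$ on $A$ and $d_B$ on $B$. Then $d\in\mathrm{Der}(A\times_\theta^{\phi,\gamma}B)$ if and only if the following assertions hold. (i) $d_A\in\mathrm{Der}(A)$ and $d_B\in\mathrm{Der}(B)$. (ii) $(\theta-\phi)(b)\,d_A(a)=(\theta-\gamma)(b)\,\big(d_A(a)-d_A(u)a\big)=0$ for all $a\in A$ and $b\in B$. (iii) $\phi(d_B(b))\,(\phi-\gamma)(y)\,u=\phi(d_B(b))\,(a-ua)=0$ for all $a\in A$ and $b,y\in B$. (iv) $\gamma\circ d_B=\phi\circ d_B$ on $B$. Furthermore, if $A$ is a Banach algebra without identity, then $$d(a,b)=\big(d_A(a)+(\theta-\gamma)(b)\,d_A(u),\ d_B(b)\big)$$ for all $a\in A$ and $b\in B$.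
   Context: A right identity of $A$ is an element $u\in A$ with $au=a$ for all $a\in A$; "without identity" means that $A$ has no two-sided identity. A derivation on an algebra $C$ is a linear map $D:C\to C$ with $D(cx)=D(c)x+cD(x)$ for all $c,x\in C$; a Jordan derivation is a linear map $D:C\to C$ with $D(c^2)=D(c)c+cD(c)$ for all $c\in C$. The sets of these are denoted $\mathrm{Der}(C)$ and $\mathrm{Der}_J(C)$. For a multiplicative linear functional $\eta$ on $B$, the $\eta$-Lau product on the vector space $A\times B$ is $$(a,b)\cdot_\eta(x,y)=(ax+\eta(y)a+\eta(b)x,\ by).$$ For nonzero multiplicative linear functionals $\theta,\phi,\gamma$ on $B$, $\mathrm{Der}_J(A\times_\theta^{\phi,\gamma}B)$ denotes the set of all linear maps $d:A\times B\to A\times B$ satisfying $$d((a,b)\cdot_\theta(a,b))=d(a,b)\cdot_\phi(a,b)+(a,b)\cdot_\gamma d(a,b)\qquad(a\in A,\ b\in B),$$ and $\mathrm{Der}(A\times_\theta^{\phi,\gamma}B)$ denotes the set of all linear maps $d:A\times B\to A\times B$ satisfying $$d((a,b)\cdot_\theta(x,y))=d(a,b)\cdot_\phi(x,y)+(a,b)\cdot_\gamma d(x,y)\qquad(a,x\in A,\ b,y\in B).$$ For $d\in\mathrm{Der}_J(A\times_\theta^{\phi,\gamma}B)$, the associated maps are $d_A(a)=\pi_A(d(a,0))$ and $d_B(b)=\pi_B(d(0,b))$, where $\pi_A,\pi_B$ are the canonical projections of $A\times B$ onto $A$ and $B$; they are the unique Jordan derivations $d_A\in\mathrm{Der}_J(A)$,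 $d_B\in\mathrm{Der}_J(B)$ with $d(a,b)=\big(d_A(a)+(2\theta-\phi-\gamma)(b)d_A(u)-\tfrac12(\phi+\gamma)(d_B(b))u,\ d_B(b)\big)$ for all $a\in A$, $b\in B$. Linear combinations of functionals are evaluated pointwise.
   Formalization: The final formula for A without identity is proved for d in Der(A×B), since it fails for general d in Der_J(A×B) (e.g. ax=f(x)a, θ=γ≠φ, d(a,b)=(f(a)v+(θ−φ)(b)v,0) with f(v)=0); A is also assumed nonzero. *)

theory Defs
  imports "HOL-Analysis.Analysis"
begin

(* The scalar field is any type of sort {real_normed_field, banach}; up to isometric
   isomorphism these are exactly the real and the complex numbers. The type classes
   already give an associative, submultiplicative, complete norm, but only
   multiplication by real scalars, hence the explicit scalar multiplication. *)
locale banach_algebra = vector_space scl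
  for scl :: "'k::{real_normed_field,banach} \<Rightarrow> 'a::{real_normed_algebra,banach} \<Rightarrow> 'a" +
  assumes scale_of_real: "scl (of_real r) x = r *\<^sub>R x"
    and norm_scale: "norm (scl c x) = norm c * norm x"
    and scale_mult_left: "scl c x * y = scl c (x * y)"
    and scale_mult_right: "x * scl c y = scl c (x * y)"

definition right_identity :: "'a::times \<Rightarrow> bool" where
  "right_identity u \<longleftrightarrow> (\<forall>a. a * u = a)"

definition two_sided_identity :: "'a::times \<Rightarrow> bool" where
  "two_sided_identity e \<longleftrightarrow> (\<forall>a. a * e = a \<and> e * a = a)"

definition multiplicative_functional ::
    "('k::field \<Rightarrow> 'b::ring \<Rightarrow> 'b) \<Rightarrow> ('b \<Rightarrow> 'k) \<Rightarrow> bool" where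
  "multiplicative_functional scl \<eta> \<longleftrightarrow>
     Vector_Spaces.linear scl (*) \<eta> \<and> (\<forall>x y. \<eta> (x * y) = \<eta> x * \<eta> y)"

definition Der :: "('k::field \<Rightarrow> 'c::ring \<Rightarrow> 'c) \<Rightarrow> ('c \<Rightarrow> 'c) set" where
  "Der scl = {D. Vector_Spaces.linear scl scl D \<and>
                   (\<forall>c x. D (c * x) = D c * x + c * D x)}"

definition lau_product ::
    "('k \<Rightarrow> 'a::ring \<Rightarrow> 'a) \<Rightarrow> ('b::ring \<Rightarrow> 'k) \<Rightarrow> 'a \<times> 'b \<Rightarrow> 'a \<times> 'b \<Rightarrow> 'a \<times> 'b" where
  "lau_product scaleA \<eta> p q =
     (fst p * fst q + scaleA (\<eta> (snd q)) (fst p) + scaleA (\<eta> (snd p)) (fst q),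
      snd p * snd q)"

definition Lau_Der ::
    "('k::field \<Rightarrow> 'a::ring \<Rightarrow> 'a) \<Rightarrow> ('k \<Rightarrow> 'b::ring \<Rightarrow> 'b) \<Rightarrow>
     ('b \<Rightarrow> 'k) \<Rightarrow> ('b \<Rightarrow> 'k) \<Rightarrow> ('b \<Rightarrow> 'k) \<Rightarrow> ('a \<times> 'b \<Rightarrow> 'a \<times> 'b) set" where
  "Lau_Der scaleA scaleB \<theta> \<phi> \<gamma> =
     {d. Vector_Spaces.linear (module_prod.scale scaleA scaleB) (module_prod.scale scaleA scaleB) d \<and>
         (\<forall>p q. d (lau_product scaleA \<theta> p q) =
                lau_product scaleA \<phi> (d p) q + lau_product scaleA \<gamma> p (d q))}"

definition Lau_Der_J ::
    "('k::field \<Rightarrow> 'a::ring \<Rightarrow> 'a) \<Rightarrow> ('k \<Rightarrow> 'b::ring \<Rightarrow> 'b) \<Rightarrow>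
     ('b \<Rightarrow> 'k) \<Rightarrow> ('b \<Rightarrow> 'k) \<Rightarrow> ('b \<Rightarrow> 'k) \<Rightarrow> ('a \<times> 'b \<Rightarrow> 'a \<times> 'b) set" where
  "Lau_Der_J scaleA scaleB \<theta> \<phi> \<gamma> =
     {d. Vector_Spaces.linear (module_prod.scale scaleA scaleB) (module_prod.scale scaleA scaleB) d \<and>
         (\<forall>p. d (lau_product scaleA \<theta> p p) =
              lau_product scaleA \<phi> (d p) p + lau_product scaleA \<gamma> p (d p))}"

definition assoc_A :: "('a \<times> 'b::zero \<Rightarrow> 'a \<times> 'b) \<Rightarrow> 'a \<Rightarrow> 'a" where
  "assoc_A d a = fst (d (a, 0))"

definition assoc_B :: "('a::zero \<times> 'b \<Rightarrow> 'a \<times> 'b) \<Rightarrow> 'b \<Rightarrow> 'b" where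
  "assoc_B d b = snd (d (0, b))"

end

theory Submission
  imports Defs
begin

text \<open>
  Write \<open>d (a, b) = (\<alpha> a + \<beta> b, \<sigma> a + \<tau> b)\<close>. Polarizing \<open>\<sigma> (a\<^sup>2) = 0\<close> against \<open>u\<close> gives
  \<open>\<sigma> (a + u a) = 0\<close>, and replacing \<open>a\<close> by \<open>u a\<close> yields \<open>\<sigma> = 0\<close>. The mixed part of the Jordan
  identity at \<open>(u, b)\<close> then determines \<open>\<beta>\<close>. The derivation identity splits into its components on
  \<open>A \<times> A\<close>, \<open>A \<times> B\<close>, \<open>B \<times> A\<close> and \<open>B \<times> B\<close>. The \<open>A \<times> B\<close> component yields
  \<open>\<gamma> \<circ> \<tau> = \<phi> \<circ> \<tau>\<close> (take \<open>a = u\<close> and multiply by \<open>u\<close>), and then \<open>(\<theta> - \<phi>)(b) \<alpha>(a) = 0\<close>. The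
  \<open>B \<times> B\<close> component multiplied by \<open>u\<close> gives \<open>(\<phi> - \<gamma>)(b) \<phi>(\<tau> y) = 0\<close>. The \<open>B \<times> A\<close> component
  reads \<open>(\<theta> - \<gamma>)(b) (\<alpha> a - \<alpha>(u) a) = \<phi>(\<tau> b) (a - u a)\<close>; since \<open>\<phi> \<circ> \<tau> = 0\<close> or
  \<open>\<phi> = \<gamma>\<close>, both sides vanish.
\<close>

text \<open>Polarized Jordan identities yield doubled terms; this cancels the factor 2.\<close>

lemma real_vector_double_eq_0_iff [simp]: "x + x = 0 \<longleftrightarrow> x = 0" for x :: "'v::real_vector"
  by (metis scaleR_2 scaleR_eq_0_iff zero_neq_numeral)

locale lau_jordan_derivation =
  A: banach_algebra scaleA + B: banach_algebra scaleB
  for scaleA :: "'k::{real_normed_field,banach} \<Rightarrow> 'a::{real_normed_algebra,banach} \<Rightarrow> 'a"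
    and scaleB :: "'k \<Rightarrow> 'b::{real_normed_algebra,banach} \<Rightarrow> 'b" +
  fixes u :: 'a and \<theta> \<phi> \<gamma> :: "'b \<Rightarrow> 'k" and d :: "'a \<times> 'b \<Rightarrow> 'a \<times> 'b"
  assumes nontrivial: "\<exists>a::'a. a \<noteq> 0"
    and right_identity: "right_identity u"
    and \<theta>: "multiplicative_functional scaleB \<theta>"
    and \<phi>: "multiplicative_functional scaleB \<phi>"
    and \<gamma>: "multiplicative_functional scaleB \<gamma>"
    and d: "d \<in> Lau_Der_J scaleA scaleB \<theta> \<phi> \<gamma>"
begin

sublocale AB: vector_space_prod scaleA scaleB ..

abbreviation \<alpha> :: "'a \<Rightarrow> 'a" where "\<alpha> \<equiv> assoc_A d"
abbreviation \<tau> :: "'b \<Rightarrow> 'b" where "\<tau> \<equiv> assoc_B d"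
definition \<beta> :: "'b \<Rightarrow> 'a" where "\<beta> b = fst (d (0, b))"

lemma mult_u [simp]: "a * u = a"
  using right_identity by (simp add: right_identity_def)

lemma u_mult_u_mult [simp]: "u * (u * a) = u * a"
  by (metis mult.assoc mult_u)

text \<open>Allows comparison of coefficients of \<open>u\<close>, which turns equations in A into
  scalar ones.\<close>

lemma u_nonzero: "u \<noteq> 0"
  using nontrivial mult_u by (metis mult_zero_right)

section \<open>Linearity of \<open>d\<close> and of its components\<close>

lemma linear_d: "Vector_Spaces.linear AB.scale AB.scale d"
  using d by (simp add: Lau_Der_J_def)

lemma d_add: "d (p + q) = d p + d q"
  using linear_d unfolding Vector_Spaces.linear_iff by blast

lemma d_scale: "d (AB.scale c p) = AB.scale c (d p)"
  using linear_d unfolding Vector_Spaces.linear_iff by blast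

lemma d_zero [simp]: "d 0 = 0"
  using d_add[of 0 0] by simp

lemma d_zero_pair [simp]: "d (0, 0) = (0, 0)"
  using d_zero by (simp add: zero_prod_def)

lemma d_jordan:
  "d (lau_product scaleA \<theta> p p) = lau_product scaleA \<phi> (d p) p + lau_product scaleA \<gamma> p (d p)"
  using d unfolding Lau_Der_J_def by blast

lemma functional_add:
  "\<theta> (x + y) = \<theta> x + \<theta> y" "\<phi> (x + y) = \<phi> x + \<phi> y" "\<gamma> (x + y) = \<gamma> x + \<gamma> y"
  using \<theta> \<phi> \<gamma> unfolding multiplicative_functional_def Vector_Spaces.linear_iff by blast+

lemma functional_mult:
  "\<theta> (x * y) = \<theta> x * \<theta> y" "\<phi> (x * y) = \<phi> x * \<phi> y" "\<gamma> (x * y) = \<gamma> x * \<gamma> y"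
  using \<theta> \<phi> \<gamma> unfolding multiplicative_functional_def by blast+

lemma functional_zero [simp]: "\<theta> 0 = 0" "\<phi> 0 = 0" "\<gamma> 0 = 0"
  using functional_add[of 0 0] by simp_all

lemma \<alpha>_add: "\<alpha> (a + x) = \<alpha> a + \<alpha> x"
  using d_add[of "(a, 0)" "(x, 0)"] by (simp add: assoc_A_def)

lemma \<alpha>_scale: "\<alpha> (scaleA c a) = scaleA c (\<alpha> a)"
  using d_scale[of c "(a, 0)"] by (simp add: assoc_A_def AB.scale_def)

lemma linear_\<alpha>: "Vector_Spaces.linear scaleA scaleA \<alpha>"
  by (simp add: Vector_Spaces.linear_iff \<alpha>_add \<alpha>_scale A.vector_space_axioms)

lemma \<tau>_add: "\<tau> (b + y) = \<tau> b + \<tau> y"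
  using d_add[of "(0, b)" "(0, y)"] by (simp add: assoc_B_def)

lemma \<tau>_scale: "\<tau> (scaleB c b) = scaleB c (\<tau> b)"
  using d_scale[of c "(0, b)"] by (simp add: assoc_B_def AB.scale_def)

lemma linear_\<tau>: "Vector_Spaces.linear scaleB scaleB \<tau>"
  by (simp add: Vector_Spaces.linear_iff \<tau>_add \<tau>_scale B.vector_space_axioms)

lemma \<tau>_zero [simp]: "\<tau> 0 = 0"
  by (simp add: assoc_B_def)

lemma \<beta>_add: "\<beta> (b + y) = \<beta> b + \<beta> y"
  using d_add[of "(0, b)" "(0, y)"] by (simp add: \<beta>_def)

lemma \<beta>_zero [simp]: "\<beta> 0 = 0"
  by (simp add: \<beta>_def)

section \<open>Normal form of a Jordan derivation\<close>

lemma d_split: "d (a, b) = d (a, 0) + d (0, b)"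
  using d_add[of "(a, 0)" "(0, b)"] by simp

lemma snd_d_eq_0 [simp]: "snd (d (a, 0)) = 0"
proof -
  have add: "snd (d (a + x, 0)) = snd (d (a, 0)) + snd (d (x, 0))" for a x
    using d_add[of "(a, 0)" "(x, 0)"] by simp
  have sq: "snd (d (a * a, 0)) = 0" for a
    using arg_cong[OF d_jordan[of "(a, 0)"], of snd] by (simp add: lau_product_def)
  \<comment> \<open>Expand the square of \<open>a + u\<close>, using \<open>a * u = a\<close>;
    \<open>sq\<close> removes the pure squares.\<close>
  have u: "snd (d (a + u * a, 0)) = 0" for a
    using sq[of "a + u"] sq[of a] sq[of u] by (simp add: add ring_distribs add.commute)
  \<comment> \<open>As \<open>u * (u * a) = u * a\<close>, the two summands coincide.\<close>
  have "snd (d (u * a, 0)) = 0"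
    using u[of "u * a"] by (simp add: add)
  then show ?thesis
    using u[of a] by (simp add: add)
qed

lemma d_eq: "d (a, b) = (\<alpha> a + \<beta> b, \<tau> b)"
  by (subst d_split) (simp add: prod_eq_iff assoc_A_def assoc_B_def \<beta>_def)

lemma \<alpha>_zero [simp]: "\<alpha> 0 = 0"
  by (simp add: assoc_A_def)

lemma \<alpha>_square: "\<alpha> (a * a) = \<alpha> a * a + a * \<alpha> a"
  using d_jordan[of "(a, 0)"] by (simp add: lau_product_def d_eq)

text \<open>Since \<open>u * u = u\<close>, the Jordan identity at \<open>u\<close> has
  \<open>\<alpha> u\<close> on both sides, where it cancels.\<close>

lemma u_mult_\<alpha>_u [simp]: "u * \<alpha> u = 0"
  using \<alpha>_square[of u] by simp

text \<open>From the Jordan identity at \<open>(a, b)\<close>, subtract its pure parts at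
  \<open>(a, 0)\<close> and \<open>(0, b)\<close>.\<close>

lemma jordan_mixed:
  "scaleA (2 * \<theta> b) (\<alpha> a) =
     \<beta> b * a + a * \<beta> b + scaleA (\<phi> b + \<gamma> b) (\<alpha> a) + scaleA (\<phi> (\<tau> b) + \<gamma> (\<tau> b)) a"
proof -
  have "\<beta> (b * b) = scaleA (\<phi> b) (\<beta> b) + scaleA (\<gamma> b) (\<beta> b)"
    using d_jordan[of "(0, b)"] by (simp add: lau_product_def d_eq)
  moreover have "\<alpha> (a * a + scaleA (\<theta> b) a + scaleA (\<theta> b) a) + \<beta> (b * b) =
      ((\<alpha> a + \<beta> b) * a + scaleA (\<phi> b) (\<alpha> a + \<beta> b) + scaleA (\<phi> (\<tau> b)) a) +
      (a * (\<alpha> a + \<beta> b) + scaleA (\<gamma> (\<tau> b)) a + scaleA (\<gamma> b) (\<alpha> a + \<beta> b))"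
    using d_jordan[of "(a, b)"] by (simp add: lau_product_def d_eq)
  moreover have "scaleA (2 * \<theta> b) (\<alpha> a) = scaleA (\<theta> b) (\<alpha> a) + scaleA (\<theta> b) (\<alpha> a)"
    by (simp only: mult_2 A.scale_left_distrib)
  ultimately show ?thesis
    by (simp add: \<alpha>_add \<alpha>_scale \<alpha>_square A.scale_left_distrib A.scale_right_distrib
        distrib_left distrib_right add_ac)
qed

lemma \<beta>_eq:
  "\<beta> b = scaleA (2 * \<theta> b - \<phi> b - \<gamma> b) (\<alpha> u) - scaleA ((\<phi> (\<tau> b) + \<gamma> (\<tau> b)) / 2) u"
proof -
  let ?s = "\<phi> (\<tau> b) + \<gamma> (\<tau> b)"
  note mixed = jordan_mixed[of b u]
  \<comment> \<open>Left multiplication by \<open>u\<close> kills the terms in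
    \<open>\<alpha> u\<close> and fixes \<open>u\<close>, so \<open>u * \<beta> b\<close> can be
    solved for.\<close>
  have "u * \<beta> b + u * \<beta> b + scaleA ?s u = 0"
    using arg_cong[OF mixed, of "\<lambda>x. u * x"]
    by (simp add: distrib_left A.scale_mult_right)
  moreover have half: "scaleA ?s u = scaleA (?s / 2) u + scaleA (?s / 2) u"
    by (subst A.scale_left_distrib[symmetric]) (simp flip: mult_2)
  ultimately have "(u * \<beta> b + scaleA (?s / 2) u) + (u * \<beta> b + scaleA (?s / 2) u) = 0"
    by (simp add: algebra_simps)
  then have "u * \<beta> b = - scaleA (?s / 2) u"
    by (simp only: real_vector_double_eq_0_iff) (simp add: eq_neg_iff_add_eq_0)
  \<comment> \<open>Inserted into \<open>mixed\<close>, the value of \<open>u * \<beta> b\<close>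
    absorbs half of the \<open>u\<close>-term and isolates \<open>\<beta> b\<close>.\<close>
  then have "scaleA (2 * \<theta> b) (\<alpha> u) = \<beta> b + scaleA (\<phi> b + \<gamma> b) (\<alpha> u) + scaleA (?s / 2) u"
    using mixed half by simp
  then show ?thesis
    by (simp add: A.scale_left_distrib A.scale_left_diff_distrib algebra_simps)
qed

text \<open>The coefficient of \<open>\<alpha> u\<close> in \<open>\<beta>_eq\<close> loses its
  summand \<open>\<theta> b - \<phi> b\<close>, and the average in front of \<open>u\<close> becomes
  \<open>\<phi> (\<tau> b)\<close>.\<close>

lemma \<beta>_eq_simplified:
  assumes "\<gamma> (\<tau> b) = \<phi> (\<tau> b)" and "scaleA (\<theta> b - \<phi> b) (\<alpha> u) = 0"
  shows "\<beta> b = scaleA (\<theta> b - \<gamma> b) (\<alpha> u) - scaleA (\<phi> (\<tau> b)) u"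
proof -
  have "2 * \<theta> b - \<phi> b - \<gamma> b = (\<theta> b - \<phi> b) + (\<theta> b - \<gamma> b)"
    by simp
  then show ?thesis
    by (subst \<beta>_eq) (simp only: A.scale_left_distrib assms, simp)
qed

section \<open>The derivation identity by components\<close>

lemma Lau_Der_iff:
  "d \<in> Lau_Der scaleA scaleB \<theta> \<phi> \<gamma> \<longleftrightarrow>
     \<alpha> \<in> Der scaleA \<and> \<tau> \<in> Der scaleB \<and>
     (\<forall>a y. scaleA (\<theta> y) (\<alpha> a) = scaleA (\<phi> y) (\<alpha> a) + a * \<beta> y + scaleA (\<gamma> (\<tau> y)) a) \<and>
     (\<forall>b x. scaleA (\<theta> b) (\<alpha> x) = \<beta> b * x + scaleA (\<phi> (\<tau> b)) x + scaleA (\<gamma> b) (\<alpha> x)) \<and>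
     (\<forall>b y. \<beta> (b * y) = scaleA (\<phi> y) (\<beta> b) + scaleA (\<gamma> b) (\<beta> y))"
  (is "?L \<longleftrightarrow> ?R")
proof
  assume ?L
  then have *: "d (lau_product scaleA \<theta> (a, b) (x, y)) =
      lau_product scaleA \<phi> (d (a, b)) (x, y) + lau_product scaleA \<gamma> (a, b) (d (x, y))" for a b x y
    by (simp add: Lau_Der_def)
  show ?R
    unfolding Der_def
    \<comment> \<open>In order, the components on A x A, B x B, A x B and B x A.\<close>
    using *[of _ 0 _ 0] *[of 0 _ 0 _] *[of _ 0 0 _] *[of 0 _ _ 0] linear_\<alpha> linear_\<tau>
    by (simp add: lau_product_def d_eq \<alpha>_scale algebra_simps)
next
  assume R: ?R
  have "d (lau_product scaleA \<theta> (a, b) (x, y)) =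
      lau_product scaleA \<phi> (d (a, b)) (x, y) + lau_product scaleA \<gamma> (a, b) (d (x, y))" for a b x y
  proof -
    have "\<alpha> (a * x) = \<alpha> a * x + a * \<alpha> x" "\<tau> (b * y) = \<tau> b * y + b * \<tau> y"
      using R by (simp_all add: Der_def)
    moreover have
      "scaleA (\<theta> y) (\<alpha> a) = scaleA (\<phi> y) (\<alpha> a) + a * \<beta> y + scaleA (\<gamma> (\<tau> y)) a"
      "scaleA (\<theta> b) (\<alpha> x) = \<beta> b * x + scaleA (\<phi> (\<tau> b)) x + scaleA (\<gamma> b) (\<alpha> x)"
      "\<beta> (b * y) = scaleA (\<phi> y) (\<beta> b) + scaleA (\<gamma> b) (\<beta> y)"
      using R by blast+
    ultimately show ?thesis
      by (simp add: lau_product_def d_eq \<alpha>_add \<alpha>_scale distrib_left distrib_right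
          A.scale_right_distrib)
  qed
  then show ?L
    using linear_d by (simp add: Lau_Der_def)
qed

text \<open>The Leibniz rule at \<open>a * u\<close> extends \<open>u_mult_\<alpha>_u\<close> to
  every left factor.\<close>

lemma mult_\<alpha>_u:
  assumes "\<alpha> \<in> Der scaleA"
  shows "a * \<alpha> u = 0"
proof -
  have "\<alpha> (a * u) = \<alpha> a * u + a * \<alpha> u"
    using assms unfolding Der_def by blast
  then show ?thesis
    by simp
qed

text \<open>In \<open>\<beta>_eq\<close> the \<open>\<alpha> u\<close> term is annihilated from the
  left and \<open>u\<close> is a right identity, so only a scalar survives.\<close>

lemma mult_\<beta>:
  assumes "\<alpha> \<in> Der scaleA"
  shows "a * \<beta> b = - scaleA ((\<phi> (\<tau> b) + \<gamma> (\<tau> b)) / 2) a"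
  by (subst \<beta>_eq) (simp add: right_diff_distrib A.scale_mult_right mult_\<alpha>_u[OF assms])

lemma Lau_Der_imp:
  assumes "d \<in> Lau_Der scaleA scaleB \<theta> \<phi> \<gamma>"
  shows "\<gamma> (\<tau> b) = \<phi> (\<tau> b)"
    and "scaleA (\<theta> b - \<phi> b) (\<alpha> a) = 0"
    and "scaleA (\<theta> b - \<gamma> b) (\<alpha> a - \<alpha> u * a) = 0"
    and "\<phi> (\<tau> b) * (\<phi> y - \<gamma> y) = 0"
    and "scaleA (\<phi> (\<tau> b)) (a - u * a) = 0"
proof -
  have \<alpha>: "\<alpha> \<in> Der scaleA" and \<tau>: "\<tau> \<in> Der scaleB"
    and AB: "scaleA (\<theta> y) (\<alpha> a) = scaleA (\<phi> y) (\<alpha> a) + a * \<beta> y + scaleA (\<gamma> (\<tau> y)) a"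
    and BA: "scaleA (\<theta> b) (\<alpha> x) = \<beta> b * x + scaleA (\<phi> (\<tau> b)) x + scaleA (\<gamma> b) (\<alpha> x)"
    and BB: "\<beta> (b * y) = scaleA (\<phi> y) (\<beta> b) + scaleA (\<gamma> b) (\<beta> y)" for a b x y
    using assms unfolding Lau_Der_iff by blast+
  show eq: "\<gamma> (\<tau> b) = \<phi> (\<tau> b)" for b
  proof -
    have "u * scaleA (\<theta> b) (\<alpha> u) =
        u * (scaleA (\<phi> b) (\<alpha> u) + u * \<beta> b + scaleA (\<gamma> (\<tau> b)) u)"
      using AB[of b u] by simp
    \<comment> \<open>So \<open>\<gamma> (\<tau> b)\<close> equals its average with
      \<open>\<phi> (\<tau> b)\<close>.\<close>
    then have "scaleA (\<gamma> (\<tau> b) - (\<phi> (\<tau> b) + \<gamma> (\<tau> b)) / 2) u = 0"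
      by (simp add: distrib_left right_diff_distrib A.scale_mult_right mult_\<beta>[OF \<alpha>]
          A.scale_left_diff_distrib)
    then show ?thesis
      using u_nonzero by (simp add: field_simps)
  qed
  have mult_\<beta>': "a * \<beta> b = - scaleA (\<phi> (\<tau> b)) a" for a b
    by (simp add: mult_\<beta>[OF \<alpha>] eq)
  show \<theta>\<phi>: "scaleA (\<theta> b - \<phi> b) (\<alpha> a) = 0" for a b
    using AB[of b a] by (simp add: mult_\<beta>' eq A.scale_left_diff_distrib)
  show \<phi>\<gamma>: "\<phi> (\<tau> b) * (\<phi> y - \<gamma> y) = 0" for b y
  proof -
    \<comment> \<open>By \<open>mult_\<beta>'\<close> this becomes a product rule for
      \<open>\<phi> \<circ> \<tau>\<close> with weights \<open>\<phi>\<close> and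
      \<open>\<gamma>\<close>. Applying \<open>\<phi>\<close> to the Leibniz rule for
      \<open>\<tau>\<close> gives \<open>\<phi>\<close> as both weights; the difference is the
      claim.\<close>
    have "u * \<beta> (y * b) = u * (scaleA (\<phi> b) (\<beta> y) + scaleA (\<gamma> y) (\<beta> b))"
      by (simp add: BB)
    then have "scaleA (\<phi> (\<tau> (y * b)) - \<phi> b * \<phi> (\<tau> y) - \<gamma> y * \<phi> (\<tau> b)) u = 0"
      by (simp add: mult_\<beta>' distrib_left A.scale_mult_right A.scale_left_diff_distrib algebra_simps)
    then have "\<phi> (\<tau> (y * b)) - \<phi> b * \<phi> (\<tau> y) - \<gamma> y * \<phi> (\<tau> b) = 0"
      using u_nonzero by simp
    moreover have "\<tau> (y * b) = \<tau> y * b + y * \<tau> b"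
      using \<tau> unfolding Der_def by blast
    ultimately show ?thesis
      by (simp add: functional_add functional_mult algebra_simps)
  qed
  note \<beta> = \<beta>_eq_simplified[OF eq \<theta>\<phi>]
  have BA': "scaleA (\<theta> b - \<gamma> b) (\<alpha> a - \<alpha> u * a) = scaleA (\<phi> (\<tau> b)) (a - u * a)" for a b
    using BA[of b a] by (simp add: \<beta> A.scale_left_diff_distrib A.scale_right_diff_distrib
        left_diff_distrib A.scale_mult_left algebra_simps)
  show *: "scaleA (\<phi> (\<tau> b)) (a - u * a) = 0" for a b
  proof (cases "\<phi> (\<tau> b) = 0")
    case False
    \<comment> \<open>The coefficient on the left of \<open>BA'\<close> is then
      \<open>\<theta> b - \<phi> b\<close>, which kills \<open>\<alpha> a\<close> and
      \<open>\<alpha> u\<close>.\<close>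
    then have "\<gamma> b = \<phi> b"
      using \<phi>\<gamma>[of b b] by simp
    then have "scaleA (\<theta> b - \<gamma> b) (\<alpha> a - \<alpha> u * a) = 0"
      using \<theta>\<phi>[of b a] \<theta>\<phi>[of b u]
      by auto
    then show ?thesis
      by (simp add: BA')
  qed simp
  then show "scaleA (\<theta> b - \<gamma> b) (\<alpha> a - \<alpha> u * a) = 0"
    by (simp add: BA')
qed

lemma Lau_DerI:
  assumes \<alpha>: "\<alpha> \<in> Der scaleA" and \<tau>: "\<tau> \<in> Der scaleB"
    and \<theta>\<phi>: "\<And>a b. scaleA (\<theta> b - \<phi> b) (\<alpha> a) = 0"
    and \<theta>\<gamma>: "\<And>a b. scaleA (\<theta> b - \<gamma> b) (\<alpha> a - \<alpha> u * a) = 0"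
    and \<phi>\<gamma>: "\<And>b y. \<phi> (\<tau> b) * (\<phi> y - \<gamma> y) = 0"
    and \<phi>\<tau>: "\<And>a b. scaleA (\<phi> (\<tau> b)) (a - u * a) = 0"
    and eq: "\<And>b. \<gamma> (\<tau> b) = \<phi> (\<tau> b)"
  shows "d \<in> Lau_Der scaleA scaleB \<theta> \<phi> \<gamma>"
  unfolding Lau_Der_iff
proof (intro conjI allI)
  note \<beta> = \<beta>_eq_simplified[OF eq \<theta>\<phi>]
  show "scaleA (\<theta> y) (\<alpha> a) = scaleA (\<phi> y) (\<alpha> a) + a * \<beta> y + scaleA (\<gamma> (\<tau> y)) a" for a y
    using \<theta>\<phi>[of y a] by (simp add: mult_\<beta>[OF \<alpha>] eq A.scale_left_diff_distrib)
  show "scaleA (\<theta> b) (\<alpha> x) = \<beta> b * x + scaleA (\<phi> (\<tau> b)) x + scaleA (\<gamma> b) (\<alpha> x)" for b x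
    using \<theta>\<gamma>[of b x] \<phi>\<tau>[of b x]
    by (simp add: \<beta> A.scale_left_diff_distrib A.scale_right_diff_distrib
        left_diff_distrib A.scale_mult_left algebra_simps
        del: A.scale_eq_0_iff A.scale_cancel_left)
  show "\<beta> (b * y) = scaleA (\<phi> y) (\<beta> b) + scaleA (\<gamma> b) (\<beta> y)" for b y
  proof -
    \<comment> \<open>Here \<open>\<phi>\<gamma>\<close> lets \<open>\<gamma> b\<close> replace
      \<open>\<phi> b\<close> in front of \<open>\<phi> (\<tau> y)\<close>.\<close>
    have "\<phi> (\<tau> (b * y)) = \<phi> y * \<phi> (\<tau> b) + \<gamma> b * \<phi> (\<tau> y)"
    proof -
      have "\<tau> (b * y) = \<tau> b * y + b * \<tau> y"
        using \<tau> unfolding Der_def by blast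
      then show ?thesis
        using \<phi>\<gamma>[of y b] by (simp add: functional_add functional_mult algebra_simps)
    qed
    \<comment> \<open>If \<open>\<alpha> u\<close> is nonzero, \<open>\<theta>\<phi>\<close> forces
      \<open>\<theta> = \<phi>\<close>, and \<open>\<phi> - \<gamma>\<close> obeys this weighted
      product rule because both are multiplicative.\<close>
    moreover have "scaleA (\<theta> (b * y) - \<gamma> (b * y)) (\<alpha> u) =
        scaleA (\<phi> y * (\<theta> b - \<gamma> b) + \<gamma> b * (\<theta> y - \<gamma> y)) (\<alpha> u)"
    proof (cases "\<alpha> u = 0")
      case False
      then have "\<theta> z = \<phi> z" for z
        using \<theta>\<phi>[of z u] by simp
      then show ?thesis
        by (simp add: functional_mult algebra_simps)
    qed simp
    ultimately show ?thesis
      by (simp add: \<beta> A.scale_left_distrib A.scale_right_diff_distrib)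
  qed
qed (fact \<alpha> \<tau>)+

section \<open>The characterization and the case without identity\<close>

lemma Lau_Der_characterization:
  "d \<in> Lau_Der scaleA scaleB \<theta> \<phi> \<gamma> \<longleftrightarrow>
     (\<alpha> \<in> Der scaleA \<and> \<tau> \<in> Der scaleB) \<and>
     (\<forall>a b. scaleA (\<theta> b - \<phi> b) (\<alpha> a) = 0 \<and> scaleA (\<theta> b - \<gamma> b) (\<alpha> a - \<alpha> u * a) = 0) \<and>
     (\<forall>a b y. scaleA (\<phi> (\<tau> b) * (\<phi> y - \<gamma> y)) u = 0 \<and> scaleA (\<phi> (\<tau> b)) (a - u * a) = 0) \<and>
     \<gamma> \<circ> \<tau> = \<phi> \<circ> \<tau>"
  (is "?L \<longleftrightarrow> ?R")
proof
  assume L: ?L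
  show ?R
    using Lau_Der_imp[OF L] L[unfolded Lau_Der_iff] by (auto simp: fun_eq_iff)
next
  assume R: ?R
  show ?L
  proof (rule Lau_DerI)
    show "\<phi> (\<tau> b) * (\<phi> y - \<gamma> y) = 0" for b y
      using R u_nonzero A.scale_eq_0_iff by blast
  qed (use R in \<open>auto simp: fun_eq_iff\<close>)
qed

lemma Lau_Der_without_identity:
  assumes L: "d \<in> Lau_Der scaleA scaleB \<theta> \<phi> \<gamma>" and "\<nexists>e::'a. two_sided_identity e"
  shows "d (a, b) = (\<alpha> a + scaleA (\<theta> b - \<gamma> b) (\<alpha> u), \<tau> b)"
proof -
  \<comment> \<open>Without a two-sided identity, \<open>u\<close> cannot be a left identity. Such
    an \<open>x\<close> forces \<open>\<phi> (\<tau> b) = 0\<close>, which removes the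
    \<open>u\<close>-term of \<open>\<beta> b\<close>.\<close>
  obtain x where "x - u * x \<noteq> 0"
    using assms(2) mult_u unfolding two_sided_identity_def by (metis eq_iff_diff_eq_0)
  then have "\<phi> (\<tau> b) = 0"
    using Lau_Der_imp(5)[OF L, of b x] by simp
  then show ?thesis
    using \<beta>_eq_simplified[OF Lau_Der_imp(1,2)[OF L]] by (simp add: d_eq)
qed

end

theorem theorem2p4:
  fixes scaleA :: "'k::{real_normed_field,banach} \<Rightarrow> 'a::{real_normed_algebra,banach} \<Rightarrow> 'a"
    and scaleB :: "'k \<Rightarrow> 'b::{real_normed_algebra,banach} \<Rightarrow> 'b"
    and u :: 'a
    and \<theta> \<phi> \<gamma> :: "'b \<Rightarrow> 'k"
    and d :: "'a \<times> 'b \<Rightarrow> 'a \<times> 'b"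
    and d\<^sub>A :: "'a \<Rightarrow> 'a" and d\<^sub>B :: "'b \<Rightarrow> 'b"
  assumes "banach_algebra scaleA" and "banach_algebra scaleB"
    and "\<exists>a::'a. a \<noteq> 0"
    and "right_identity u"
    and "multiplicative_functional scaleB \<theta>" and "\<exists>b. \<theta> b \<noteq> 0"
    and "multiplicative_functional scaleB \<phi>" and "\<exists>b. \<phi> b \<noteq> 0"
    and "multiplicative_functional scaleB \<gamma>" and "\<exists>b. \<gamma> b \<noteq> 0"
    and "d \<in> Lau_Der_J scaleA scaleB \<theta> \<phi> \<gamma>"
    and "d\<^sub>A = assoc_A d" and "d\<^sub>B = assoc_B d"
  shows "(d \<in> Lau_Der scaleA scaleB \<theta> \<phi> \<gamma> \<longleftrightarrow>
            (d\<^sub>A \<in> Der scaleA \<and> d\<^sub>B \<in> Der scaleB) \<and>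
            (\<forall>a b. scaleA (\<theta> b - \<phi> b) (d\<^sub>A a) = 0 \<and>
                   scaleA (\<theta> b - \<gamma> b) (d\<^sub>A a - d\<^sub>A u * a) = 0) \<and>
            (\<forall>a b y. scaleA (\<phi> (d\<^sub>B b) * (\<phi> y - \<gamma> y)) u = 0 \<and>
                     scaleA (\<phi> (d\<^sub>B b)) (a - u * a) = 0) \<and>
            (\<gamma> \<circ> d\<^sub>B = \<phi> \<circ> d\<^sub>B)) \<and>
         (d \<in> Lau_Der scaleA scaleB \<theta> \<phi> \<gamma> \<and> \<not> (\<exists>e::'a. two_sided_identity e) \<longrightarrow>
            (\<forall>a b. d (a, b) = (d\<^sub>A a + scaleA (\<theta> b - \<gamma> b) (d\<^sub>A u), d\<^sub>B b)))"
proof -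
  interpret banach_algebra scaleA by fact
  interpret B: banach_algebra scaleB by fact
  interpret lau_jordan_derivation scaleA scaleB u \<theta> \<phi> \<gamma> d
    by unfold_locales fact+
  show ?thesis
    unfolding \<open>d\<^sub>A = assoc_A d\<close> \<open>d\<^sub>B = assoc_B d\<close>
    using Lau_Der_characterization Lau_Der_without_identity by blast
qed

end
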